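(* Let $\ell$, $m$, $n$ be non-negative integers such that $\ell+m+n\ge 2$. Then $$\sum_{k=0}^\infty \frac{\left(\frac12\right)_k^2}{k!^2}\,\frac{1-2\ell+4k}{\prod_{j=1}^\ell(2k-2j+1)\,\prod_{j=1}^m(2k-2j+1)\,\prod_{j=1}^n(k+j)}=\frac{(-1)^{\ell+m}}{2^{\ell+m}}\,\frac{(\ell+m+n-2)!\,(\ell-m+n)\,(1-2\ell)}{\left(\frac12\right)_\ell\left(\frac12\right)_m\left(\frac12\right)_{\ell+n}\left(\frac12\right)_{m+n}}\,\frac1\pi.$$ In particular, for non-negative integers $m,n$ with $m+n\ge2$, $$\sum_{k=0}^\infty \frac{\left(\frac12\right)_k^2}{k!^2}\,\frac{1+4k}{\prod_{j=1}^m(2k-2j+1)\,\prod_{j=1}^n(k+j)}=\frac{(-1)^m}{2^m}\,\frac{(m+n-2)!\,(n-m)}{\left(\frac12\right)_m\left(\frac12\right)_n\left(\frac12\right)_{m+n}}\,\frac1\pi,$$ and for integers $n\ge2$, $$\sum_{k=0}^\infty \frac{\left(\frac12\right)_k^2}{k!^2}\,\frac{1+4k}{\prod_{j=1}^n(k+j)}=\frac{(n-2)!\,n}{\left(\frac12\right)_n^2}\,\frac1\pi,$$ $$\sum_{k=0}^\infty \frac{\left(\frac12\right)_k^2}{k!^2}\,\frac{1+4k}{\prod_{j=1}^n(2k-2j+1)}=\frac{(-1)^{n+1}}{2^n}\,\frac{(n-2)!\,n}{\left(\frac12\right)_n^2}\,\frac1\pi,$$ $$\sum_{k=0}^\infty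 \frac{\left(\frac12\right)_k^2}{k!^2}\,\frac{1-2n+4k}{\prod_{j=1}^n(2k-2j+1)}=\frac{(-1)^n}{2^n}\,\frac{(n-2)!\,n\,(1-2n)}{\left(\frac12\right)_n^2}\,\frac1\pi.$$
   Context: $(x)_n=\prod_{j=0}^{n-1}(x+j)$ is the Pochhammer symbol. Empty products equal $1$. *)

theory Defs
  imports Complex_Main
begin

end

theory Submission
  imports Defs "HOL-Analysis.Gamma_Function"
begin

text \<open>
  Since \<open>(1/2)\<^sub>k / (\<Prod>j=1..l. 2k - 2j + 1) = (1/2 - l)\<^sub>k / ((-2)^l (1/2)\<^sub>l)\<close> and
  \<open>k! (\<Prod>j=1..n. k + j) = n! (n + 1)\<^sub>k\<close>, the series is, up to a constant factor, the
  hypergeometric series with terms \<open>(A)\<^sub>k (B)\<^sub>k / (k! (C)\<^sub>k)\<close> for \<open>A = 1/2 - l\<close>,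
  \<open>B = 1/2 - m\<close>, \<open>C = n + 1\<close>, weighted by the linear factor \<open>2A + 4k\<close>. The condition
  \<open>l + m + n \<ge> 2\<close> says exactly that \<open>C - A - B > 1\<close>, which makes the series converge
  absolutely even with a weight linear in \<open>k\<close>.

  The unweighted series is evaluated by Gauss's theorem \<open>gauss_summation\<close>. The factor \<open>k\<close> cancels
  against \<open>k!\<close> and raises all three parameters by one, so the series with weight \<open>k\<close> is again a
  Gauss series. Both values have the common factor
  \<open>\<Gamma>(C) \<Gamma>(C-A-B-1) / (\<Gamma>(C-A) \<Gamma>(C-B))\<close>, and the combination with weight \<open>2A + 4k\<close> leaves
  the product \<open>2A (C - A + B - 1) = (1 - 2l) (l - m + n)\<close> in front of it
  (\<open>gauss_summation_linear_weight\<close>). For half-integer \<open>A\<close> and \<open>B\<close> the two Gamma values in the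
  denominator each contribute a factor \<open>\<surd>\<pi>\<close>, whence the \<open>1/\<pi>\<close>.

  Gauss's theorem is proved by the classical argument for real parameters. Let \<open>F(C)\<close> be the sum of
  the series as a function of \<open>C\<close>. A telescoping identity gives
  \<open>C (C-A-B) F(C) = (C-A) (C-B) F(C+1)\<close> (\<open>gauss_sum_contiguous\<close>). Iterating it \<open>N\<close> times turns
  \<open>F(C)\<close> into a quotient of Pochhammer symbols times \<open>F(C+N)\<close>. As \<open>N\<close> grows, \<open>F(C+N)\<close> tends
  to \<open>1\<close>, because only the term with \<open>k = 0\<close> survives, and the quotient tends to the claimed
  product of Gamma values by the limit formula that defines \<open>1/\<Gamma>\<close>.
\<close>

section \<open>Gauss's summation of the hypergeometric series at one\<close>

definition gauss_term :: "real \<Rightarrow> real \<Rightarrow> real \<Rightarrow> nat \<Rightarrow> real" where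
  "gauss_term A B C k = pochhammer A k * pochhammer B k / (pochhammer C k * fact k)"

lemma gauss_term_0 [simp]: "gauss_term A B C 0 = 1"
  by (simp add: gauss_term_def)

lemma pochhammer_nonzero:
  fixes C :: real
  assumes "C \<notin> \<int>\<^sub>\<le>\<^sub>0"
  shows "pochhammer C k \<noteq> 0"
  using assms pochhammer_eq_0_imp_nonpos_Int by blast

lemma gauss_term_Suc:
  "gauss_term A B C (Suc k) = gauss_term A B C k * ((A + k) * (B + k) / ((C + k) * real (Suc k)))"
  by (simp add: gauss_term_def pochhammer_Suc add_ac mult_ac)

text \<open>This turns the weight \<open>k\<close> into a shift of all three parameters.\<close>

lemma gauss_term_shift:
  "real (Suc k) * gauss_term A B C (Suc k) = A * B / C * gauss_term (A + 1) (B + 1) (C + 1) k"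
  by (simp add: gauss_term_def pochhammer_rec)

lemma rGamma_series_real:
  assumes "n > 0"
  shows "rGamma_series a n = pochhammer a (Suc n) / (fact n * real n powr a)"
  using assms by (simp add: rGamma_series_def powr_def)

text \<open>
  Euler's limit formula says that \<open>(a)\<^sub>n\<^sub>+\<^sub>1\<close> grows like \<open>n! n powr a / \<Gamma>(a)\<close>. Applied to the three
  Pochhammer symbols, it yields the exact power of \<open>n\<close> in the terms, from which both summability and
  the vanishing of the boundary term in the telescoping argument are read off.
\<close>

lemma gauss_term_asymptotics:
  assumes C: "C \<notin> \<int>\<^sub>\<le>\<^sub>0"
  shows "(\<lambda>n. real (Suc n) * gauss_term A B C (Suc n) / real n powr (A + B - C))
           \<longlonglongrightarrow> rGamma A * rGamma B / rGamma C"
proof -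
  have "eventually (\<lambda>n. rGamma_series A n * rGamma_series B n / rGamma_series C n =
          real (Suc n) * gauss_term A B C (Suc n) / real n powr (A + B - C)) sequentially"
    using eventually_gt_at_top[of "0::nat"]
  proof eventually_elim
    case (elim n)
    \<comment> \<open>The Pochhammer symbols, factorials and powers are made variables, so that the cancellation
        is one of a rational expression.\<close>
    have *: "a / (f * p) * (b / (f * q)) / (c / (f * r)) = s * (a * b / (c * (s * f))) / (p * q / r)"
      if "f \<noteq> 0" "p \<noteq> 0" "q \<noteq> 0" "r \<noteq> 0" "s \<noteq> 0" "c \<noteq> 0" for a b c f p q r s :: real
      using that by (simp add: field_simps)
    show ?case
      unfolding rGamma_series_real[OF elim] gauss_term_def fact_Suc powr_diff powr_add
      by (rule *) (use elim pochhammer_nonzero[OF C] in \<open>auto simp del: of_nat_Suc\<close>)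
  qed
  moreover have "(\<lambda>n. rGamma_series A n * rGamma_series B n / rGamma_series C n)
                   \<longlonglongrightarrow> rGamma A * rGamma B / rGamma C"
    using C by (intro tendsto_intros) (simp add: rGamma_eq_zero_iff)
  ultimately show ?thesis
    using Lim_transform_eventually by fast
qed

lemma gauss_term_summable_abs:
  assumes C: "C \<notin> \<int>\<^sub>\<le>\<^sub>0" and conv: "C - A - B > 0"
  shows "summable (\<lambda>k. \<bar>gauss_term A B C k\<bar>)"
proof -
  have "(\<lambda>n. (real (Suc n) * gauss_term A B C (Suc n) / real n powr (A + B - C)) * (real n / real (Suc n)))
          \<longlonglongrightarrow> rGamma A * rGamma B / rGamma C * 1"
    by (intro tendsto_mult gauss_term_asymptotics C LIMSEQ_n_over_Suc_n)
  moreover have "eventually (\<lambda>n. (real (Suc n) * gauss_term A B C (Suc n) / real n powr (A + B - C)) * (real n / real (Suc n))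
                   = gauss_term A B C (Suc n) / real n powr (A + B - C - 1)) sequentially"
    using eventually_gt_at_top[of "0::nat"]
    by eventually_elim (simp add: powr_diff divide_simps del: of_nat_Suc)
  ultimately have "(\<lambda>n. gauss_term A B C (Suc n) / real n powr (A + B - C - 1))
          \<longlonglongrightarrow> rGamma A * rGamma B / rGamma C * 1"
    using Lim_transform_eventually by fast
  then have "(\<lambda>n. gauss_term A B C (Suc n)) \<in> O(\<lambda>n. real n powr (A + B - C - 1))"
    by (rule bigoI_tendsto) (use eventually_gt_at_top[of "0::nat"] in eventually_elim, simp)
  then have "(\<lambda>n. \<bar>gauss_term A B C (Suc n)\<bar>) \<in> O(\<lambda>n. real n powr (A + B - C - 1))"
    by simp
  moreover have "summable (\<lambda>n. norm (real n powr (A + B - C - 1)))"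
    using conv by (simp add: summable_real_powr_iff)
  ultimately have "summable (\<lambda>n. \<bar>gauss_term A B C (Suc n)\<bar>)"
    by (rule summable_comparison_test_bigo[rotated])
  then show ?thesis
    by (subst (asm) summable_Suc_iff)
qed

lemma gauss_term_summable:
  assumes "C \<notin> \<int>\<^sub>\<le>\<^sub>0" "C - A - B > 0"
  shows "summable (gauss_term A B C)"
  using gauss_term_summable_abs[OF assms] by (rule summable_rabs_cancel)

lemma gauss_term_times_index_tendsto_0:
  assumes C: "C \<notin> \<int>\<^sub>\<le>\<^sub>0" and conv: "C - A - B > 0"
  shows "(\<lambda>k. real k * gauss_term A B C k) \<longlonglongrightarrow> 0"
proof -
  have "(\<lambda>n. real n powr (A + B - C)) \<longlonglongrightarrow> 0"
    using conv by (intro tendsto_neg_powr filterlim_real_sequentially) auto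
  then have "(\<lambda>n. (real (Suc n) * gauss_term A B C (Suc n) / real n powr (A + B - C)) * real n powr (A + B - C))
          \<longlonglongrightarrow> rGamma A * rGamma B / rGamma C * 0"
    by (intro tendsto_mult gauss_term_asymptotics C)
  moreover have "eventually (\<lambda>n. (real (Suc n) * gauss_term A B C (Suc n) / real n powr (A + B - C)) * real n powr (A + B - C)
            = real (Suc n) * gauss_term A B C (Suc n)) sequentially"
    using eventually_gt_at_top[of "0::nat"] by eventually_elim simp
  ultimately have "(\<lambda>n. real (Suc n) * gauss_term A B C (Suc n)) \<longlonglongrightarrow> rGamma A * rGamma B / rGamma C * 0"
    using Lim_transform_eventually by fast
  then show ?thesis
    by (subst (asm) filterlim_sequentially_Suc) simp
qed

lemma not_nonpos_Int_plus_nat: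
  fixes C :: real
  assumes "C \<notin> \<int>\<^sub>\<le>\<^sub>0"
  shows "C + real N \<notin> \<int>\<^sub>\<le>\<^sub>0"
proof
  assume "C + real N \<in> \<int>\<^sub>\<le>\<^sub>0"
  then have "C + real N - real N \<in> \<int>\<^sub>\<le>\<^sub>0"
    by (intro nonpos_Ints_diff_Nats) auto
  with assms show False by simp
qed

text \<open>
  The termwise difference of the two sides telescopes: it is \<open>g k - g (k + 1)\<close> with
  \<open>g k = C k (A)\<^sub>k (B)\<^sub>k / (k! (C)\<^sub>k)\<close>, where \<open>g\<close> vanishes at \<open>k = 0\<close> and at infinity.
\<close>

lemma gauss_sum_contiguous:
  assumes C: "C \<notin> \<int>\<^sub>\<le>\<^sub>0" and conv: "C - A - B > 0"
  shows "C * (C - A - B) * suminf (gauss_term A B C) =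
         (C - A) * (C - B) * suminf (gauss_term A B (C + 1))"
proof -
  have C1: "C + 1 \<notin> \<int>\<^sub>\<le>\<^sub>0"
    using not_nonpos_Int_plus_nat[OF C, of 1] by simp
  have nz: "C + real k \<noteq> 0" for k
    using C plus_of_nat_eq_0_imp by blast
  have shift: "gauss_term A B (C + 1) k = gauss_term A B C k * (C / (C + k))" for k
  proof -
    have "C * pochhammer (C + 1) k = (C + k) * pochhammer C k"
      by (metis pochhammer_rec pochhammer_rec')
    then have "pochhammer (C + 1) k = (C + k) * pochhammer C k / C"
      using nz[of 0] by (simp add: eq_divide_eq mult_ac)
    then show ?thesis
      by (simp add: gauss_term_def mult_ac)
  qed
  \<comment> \<open>Up to the factor \<open>C / (C + k)\<close>, both the termwise difference and \<open>g k - g (k + 1)\<close> equal the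
      \<open>k\<close>-th term times \<open>k (C - A - B) - A B\<close>.\<close>
  define g where "g k = C * (real k * gauss_term A B C k)" for k
  have step: "C * (C - A - B) * gauss_term A B C k - (C - A) * (C - B) * gauss_term A B (C + 1) k
                = g k - g (Suc k)" for k
  proof -
    have "g (Suc k) = C * gauss_term A B C k * ((A + k) * (B + k) / (C + k))"
      unfolding g_def gauss_term_Suc by (simp add: mult_ac del: of_nat_Suc)
    then have "g k - g (Suc k) = C * gauss_term A B C k * (k - (A + k) * (B + k) / (C + k))"
      by (simp add: g_def algebra_simps)
    also have "k - (A + k) * (B + k) / (C + k) = C - A - B - (C - A) * (C - B) / (C + k)"
      using nz[of k] by (simp add: field_simps)
    also have "C * gauss_term A B C k * (C - A - B - (C - A) * (C - B) / (C + k)) =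
               C * (C - A - B) * gauss_term A B C k - (C - A) * (C - B) * gauss_term A B (C + 1) k"
    proof -
      have "C * t * (d - e / s) = C * d * t - e * (t * (C / s))" for d e s t :: real
        by (simp add: right_diff_distrib mult_ac)
      then show ?thesis by (simp only: shift)
    qed
    finally show ?thesis ..
  qed
  have "g \<longlonglongrightarrow> C * 0"
    unfolding g_def by (intro tendsto_mult tendsto_const gauss_term_times_index_tendsto_0 C conv)
  then have "(\<lambda>k. g k - g (Suc k)) sums 0"
    using telescope_sums'[of g 0] by (simp add: g_def)
  then have "(\<lambda>k. C * (C - A - B) * gauss_term A B C k - (C - A) * (C - B) * gauss_term A B (C + 1) k) sums 0"
    by (simp add: step)
  moreover have "(\<lambda>k. C * (C - A - B) * gauss_term A B C k - (C - A) * (C - B) * gauss_term A B (C + 1) k)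
      sums (C * (C - A - B) * suminf (gauss_term A B C) - (C - A) * (C - B) * suminf (gauss_term A B (C + 1)))"
    using C C1 conv by (intro sums_diff sums_mult summable_sums gauss_term_summable) auto
  ultimately have "0 = C * (C - A - B) * suminf (gauss_term A B C) - (C - A) * (C - B) * suminf (gauss_term A B (C + 1))"
    by (rule sums_unique2)
  then show ?thesis by simp
qed

lemma gauss_sum_shift:
  assumes C: "C \<notin> \<int>\<^sub>\<le>\<^sub>0" and conv: "C - A - B > 0"
  shows "suminf (gauss_term A B C) =
    pochhammer (C - A) N * pochhammer (C - B) N / (pochhammer C N * pochhammer (C - A - B) N) *
    suminf (gauss_term A B (C + real N))"
proof (induction N)
  case (Suc N)
  have *: "C + real N \<noteq> 0" "C - A - B + real N \<noteq> 0"
    using plus_of_nat_eq_0_imp[of C N] C conv by auto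
  have "(C + N) * (C - A - B + N) * suminf (gauss_term A B (C + N)) =
        (C - A + N) * (C - B + N) * suminf (gauss_term A B (C + Suc N))"
    using gauss_sum_contiguous[of "C + N" A B] not_nonpos_Int_plus_nat[OF C, of N] conv
    by (simp add: algebra_simps)
  then have "suminf (gauss_term A B (C + N)) =
        (C - A + N) * (C - B + N) * suminf (gauss_term A B (C + Suc N)) / ((C + N) * (C - A - B + N))"
    using * by (simp add: eq_divide_eq mult_ac)
  then show ?case
    unfolding Suc.IH by (simp add: pochhammer_Suc mult_ac)
qed simp

text \<open>
  Raising the lower parameter from \<open>D\<close> to \<open>x\<close> increases every factor of its Pochhammer symbol, but
  the gain in the first factor alone, \<open>x / D\<close>, already suffices to make all terms but the one with
  index zero vanish uniformly as \<open>x\<close> grows.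
\<close>

lemma gauss_term_decay:
  assumes "0 < D" "D \<le> x"
  shows "\<bar>gauss_term A B x (Suc k)\<bar> \<le> D / x * \<bar>gauss_term A B D (Suc k)\<bar>"
proof -
  have pos: "pochhammer (D + 1) k > 0" "pochhammer (x + 1) k > 0"
    using assms by (auto intro!: pochhammer_pos)
  have "pochhammer (D + 1) k \<le> pochhammer (x + 1) k"
    unfolding pochhammer_prod using assms by (intro prod_mono) auto
  then have "1 / pochhammer (x + 1) k \<le> 1 / pochhammer (D + 1) k"
    using pos by (intro divide_left_mono) auto
  then have "1 / pochhammer x (Suc k) \<le> D / x * (1 / pochhammer D (Suc k))"
    using mult_left_mono[of "1 / pochhammer (x + 1) k" "1 / pochhammer (D + 1) k" "1 / x"] assms
    by (simp add: pochhammer_rec)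
  then have "\<bar>pochhammer A (Suc k) * pochhammer B (Suc k)\<bar> / fact (Suc k) * (1 / pochhammer x (Suc k))
      \<le> \<bar>pochhammer A (Suc k) * pochhammer B (Suc k)\<bar> / fact (Suc k) * (D / x * (1 / pochhammer D (Suc k)))"
    by (intro mult_left_mono) auto
  moreover have "pochhammer x (Suc k) > 0" "pochhammer D (Suc k) > 0"
    using assms by (auto intro!: pochhammer_pos)
  ultimately show ?thesis
    unfolding gauss_term_def abs_divide abs_mult by (simp add: mult_ac del: fact_Suc)
qed

text \<open>
  All terms with \<open>k > 0\<close> are compared with those of one fixed absolutely convergent series, whose lower
  parameter \<open>D\<close> is chosen large enough for convergence and positivity.
\<close>

lemma gauss_sum_tendsto_1:
  "(\<lambda>N. suminf (gauss_term A B (C + real N))) \<longlonglongrightarrow> 1"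
proof -
  define D where "D = max 1 (A + B + 1)"
  have D: "D > 0" "D - A - B > 0" by (auto simp: D_def)
  have nn: "x \<notin> \<int>\<^sub>\<le>\<^sub>0" if "x > 0" for x :: real
    using that nonpos_Ints_nonpos[of x] by auto
  define S where "S = (\<Sum>k. \<bar>gauss_term A B D (Suc k)\<bar>)"
  have sumS: "summable (\<lambda>k. \<bar>gauss_term A B D (Suc k)\<bar>)"
    using gauss_term_summable_abs[OF nn D(2)] D by (subst summable_Suc_iff) auto
  have bound: "\<bar>suminf (gauss_term A B x) - 1\<bar> \<le> D / x * S" if x: "x \<ge> D" for x
  proof -
    have cx: "x \<notin> \<int>\<^sub>\<le>\<^sub>0" "x - A - B > 0" using x D nn[of x] by auto
    have sumx: "summable (\<lambda>k. \<bar>gauss_term A B x (Suc k)\<bar>)"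
      using gauss_term_summable_abs[OF cx] by (subst summable_Suc_iff)
    have "suminf (gauss_term A B x) - 1 = (\<Sum>k. gauss_term A B x (Suc k))"
      using suminf_split_head[OF gauss_term_summable[OF cx]] by simp
    also have "\<bar>\<dots>\<bar> \<le> (\<Sum>k. \<bar>gauss_term A B x (Suc k)\<bar>)"
      by (rule summable_rabs[OF sumx])
    also have "\<dots> \<le> (\<Sum>k. D / x * \<bar>gauss_term A B D (Suc k)\<bar>)"
      using x D by (intro suminf_le gauss_term_decay sumx summable_mult sumS) auto
    also have "\<dots> = D / x * S"
      unfolding S_def by (rule suminf_mult[OF sumS])
    finally show ?thesis .
  qed
  have top: "filterlim (\<lambda>N. C + real N) at_top sequentially"
    by (intro filterlim_tendsto_add_at_top[OF tendsto_const] filterlim_real_sequentially)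
  have "(\<lambda>N. suminf (gauss_term A B (C + real N)) - 1) \<longlonglongrightarrow> 0"
  proof (rule Lim_null_comparison)
    show "eventually (\<lambda>N. norm (suminf (gauss_term A B (C + real N)) - 1) \<le> D / (C + real N) * S) sequentially"
      using filterlim_at_top[THEN iffD1, OF top, rule_format, of D]
      by eventually_elim (unfold real_norm_def, rule bound)
    have "(\<lambda>N. D / (C + real N) * S) \<longlonglongrightarrow> 0 * S"
      by (intro tendsto_mult tendsto_const real_tendsto_divide_at_top[OF tendsto_const top])
    then show "(\<lambda>N. D / (C + real N) * S) \<longlonglongrightarrow> 0" by simp
  qed
  then show ?thesis
    by (simp add: LIM_zero_iff)
qed

text \<open>
  The quotient of Pochhammer symbols in \<open>gauss_sum_shift\<close> is a quotient of terms of the sequences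
  converging to \<open>1/\<Gamma>\<close>: their factorials cancel, and so do their powers of \<open>n\<close>, because
  \<open>(C - A) + (C - B) = C + (C - A - B)\<close>. Writing the numerator with \<open>rGamma\<close> makes the formula cover the
  case of a pole of \<open>\<Gamma>\<close> at \<open>C - A\<close> or \<open>C - B\<close>, where the sum is zero.
\<close>

theorem gauss_summation:
  assumes C: "C \<notin> \<int>\<^sub>\<le>\<^sub>0" and conv: "C - A - B > 0"
  shows "gauss_term A B C sums
           (Gamma C * Gamma (C - A - B) * rGamma (C - A) * rGamma (C - B))"
proof -
  let ?F = "\<lambda>C. suminf (gauss_term A B C)"
  let ?R = "rGamma (C - A) * rGamma (C - B) / (rGamma C * rGamma (C - A - B))"
  let ?r = "\<lambda>n. rGamma_series (C - A) n * rGamma_series (C - B) n /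
                  (rGamma_series C n * rGamma_series (C - A - B) n)"
  have E: "C - A - B \<notin> \<int>\<^sub>\<le>\<^sub>0"
    using conv nonpos_Ints_nonpos[of "C - A - B"] by auto
  have "?r \<longlonglongrightarrow> ?R"
    using C E by (intro tendsto_intros) (auto simp: rGamma_eq_zero_iff)
  moreover have "(\<lambda>n. ?F (C + real (Suc n))) \<longlonglongrightarrow> 1"
    by (rule LIMSEQ_Suc[OF gauss_sum_tendsto_1])
  ultimately have "(\<lambda>n. ?r n * ?F (C + real (Suc n))) \<longlonglongrightarrow> ?R * 1"
    by (rule tendsto_mult)
  moreover have "eventually (\<lambda>n. ?r n * ?F (C + real (Suc n)) = ?F C) sequentially"
    using eventually_gt_at_top[of "0::nat"]
  proof eventually_elim
    case (elim n)
    have *: "a / (f * (c * e)) * (b / (f * (c * d))) / (p / (f * c) * (q / (f * (c * d * e)))) = a * b / (p * q)"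
      if "f \<noteq> 0" "c \<noteq> 0" "d \<noteq> 0" "e \<noteq> 0" for a b c d e f p q :: real
      using that by (simp add: field_simps)
    have powr_split: "real n powr (C - A) = real n powr C * real n powr (- A)"
      "real n powr (C - B) = real n powr C * real n powr (- B)"
      "real n powr (C - A - B) = real n powr C * real n powr (- B) * real n powr (- A)"
      by (simp_all only: diff_conv_add_uminus powr_add mult_ac)
    have "?r n = pochhammer (C - A) (Suc n) * pochhammer (C - B) (Suc n) /
                 (pochhammer C (Suc n) * pochhammer (C - A - B) (Suc n))"
      unfolding rGamma_series_real[OF elim] powr_split
      by (rule *) (use elim in auto)
    then show ?case
      using gauss_sum_shift[OF C conv, of "Suc n"] by simp
  qed
  ultimately have "(\<lambda>n. ?F C) \<longlonglongrightarrow> ?R * 1"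
    using Lim_transform_eventually by fast
  then have "?F C = ?R"
    unfolding mult_1_right by (rule LIMSEQ_unique[OF tendsto_const])
  also have "?R = Gamma C * Gamma (C - A - B) * rGamma (C - A) * rGamma (C - B)"
    by (simp add: Gamma_def divide_inverse mult_ac)
  finally show ?thesis
    using summable_sums[OF gauss_term_summable[OF C conv]] by simp
qed

section \<open>The weighted series\<close>

lemma gauss_summation_index_weight:
  assumes C: "C \<notin> \<int>\<^sub>\<le>\<^sub>0" and conv: "C - A - B > 1"
  shows "(\<lambda>k. real k * gauss_term A B C k) sums
           (A * B * Gamma C * Gamma (C - A - B - 1) * rGamma (C - A) * rGamma (C - B))"
proof -
  have C1: "C + 1 \<notin> \<int>\<^sub>\<le>\<^sub>0"
    using not_nonpos_Int_plus_nat[OF C, of 1] by simp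
  have [simp]: "C \<noteq> 0" using C by auto
  have "gauss_term (A + 1) (B + 1) (C + 1) sums
          (Gamma (C + 1) * Gamma (C - A - B - 1) * rGamma (C - A) * rGamma (C - B))"
    using gauss_summation[OF C1, of "A + 1" "B + 1"] conv by (simp add: algebra_simps)
  from sums_mult[OF this, of "A * B / C"]
  have "(\<lambda>k. real (Suc k) * gauss_term A B C (Suc k)) sums
          (A * B * Gamma C * Gamma (C - A - B - 1) * rGamma (C - A) * rGamma (C - B))"
    unfolding gauss_term_shift using C by (simp add: Gamma_plus1 mult_ac)
  then show ?thesis
    by (subst (asm) sums_Suc_iff) simp
qed

text \<open>
  By \<open>\<Gamma>(C-A-B) = (C-A-B-1) \<Gamma>(C-A-B-1)\<close> the two parts combine with the coefficient
  \<open>2A (C-A-B-1) + 4 A B = 2A (C-A+B-1)\<close>.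
\<close>

lemma gauss_summation_linear_weight:
  assumes C: "C \<notin> \<int>\<^sub>\<le>\<^sub>0" and conv: "C - A - B > 1"
  shows "(\<lambda>k. (2 * A + 4 * real k) * gauss_term A B C k) sums
    (2 * A * (C - A + B - 1) * Gamma C * Gamma (C - A - B - 1) * rGamma (C - A) * rGamma (C - B))"
proof -
  have "Gamma (C - A - B) = (C - A - B - 1) * Gamma (C - A - B - 1)"
  proof -
    have "C - A - B - 1 \<notin> \<int>\<^sub>\<le>\<^sub>0"
      using conv nonpos_Ints_nonpos[of "C - A - B - 1"] by auto
    from Gamma_plus1[OF this] show ?thesis by simp
  qed
  then have "gauss_term A B C sums
      (Gamma C * ((C - A - B - 1) * Gamma (C - A - B - 1)) * rGamma (C - A) * rGamma (C - B))"
    using gauss_summation[OF C, of A B] conv by simp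
  from sums_add[OF sums_mult[OF this, of "2 * A"]
                   sums_mult[OF gauss_summation_index_weight[OF C conv], of 4]]
  show ?thesis
    by (simp add: algebra_simps)
qed

section \<open>Half-integer parameters\<close>

text \<open>
  Up to a power of two, the product of odd numbers is \<open>(k + 1/2 - l)\<^sub>l\<close>, so both sides are evaluations of
  \<open>(1/2 - l)\<^sub>k\<^sub>+\<^sub>l\<close>, split after the first \<open>k\<close> or the first \<open>l\<close> factors; the latter are \<open>(-1)^l (1/2)\<^sub>l\<close>.
\<close>

lemma prod_odd_pochhammer:
  "(\<Prod>j=1..l. 2 * real k - 2 * real j + 1) * pochhammer (1/2 - real l) k =
     (-2) ^ l * pochhammer (1/2) l * pochhammer (1/2) k"
proof (induction l)
  case (Suc l)
  define x where "x = 1/2 - real l"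
  have x: "1/2 - real (Suc l) = x - 1" "2 * real k - 2 * real (Suc l) + 1 = 2 * (x - 1 + real k)"
    "-2 * (1/2 + real l) = 2 * (x - 1)"
    by (simp_all add: x_def)
  have "(x - 1) * pochhammer x k = (x - 1 + real k) * pochhammer (x - 1) k"
    using pochhammer_rec[of "x - 1" k] pochhammer_rec'[of "x - 1" k] by simp
  then have *: "(2 * real k - 2 * real (Suc l) + 1) * pochhammer (1/2 - real (Suc l)) k =
        -2 * (1/2 + real l) * pochhammer (1/2 - real l) k"
    unfolding x x_def[symmetric] by (metis mult.assoc)
  have "(\<Prod>j=1..Suc l. 2 * real k - 2 * real j + 1) * pochhammer (1/2 - real (Suc l)) k =
        (\<Prod>j=1..l. 2 * real k - 2 * real j + 1) *
          ((2 * real k - 2 * real (Suc l) + 1) * pochhammer (1/2 - real (Suc l)) k)"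
    by (simp only: prod.nat_ivl_Suc' mult_ac)
  also have "\<dots> = -2 * (1/2 + real l) *
        ((\<Prod>j=1..l. 2 * real k - 2 * real j + 1) * pochhammer (1/2 - real l) k)"
    unfolding * by (simp add: mult_ac)
  finally show ?case
    unfolding Suc.IH pochhammer_Suc power_Suc by (simp only: mult_ac)
qed simp

lemma prod_odd_nonzero: "(\<Prod>j=1..l. 2 * real k - 2 * real j + 1) \<noteq> 0"
proof -
  have "2 * real k - 2 * real j + 1 \<noteq> 0" for j
  proof
    assume "2 * real k - 2 * real j + 1 = 0"
    then have "2 * k + 1 = 2 * j" by linarith
    then show False by presburger
  qed
  then show ?thesis by simp
qed

lemma prod_odd_quotient:
  "pochhammer (1/2) k / (\<Prod>j=1..l. 2 * real k - 2 * real j + 1) =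
     pochhammer (1/2 - real l) k / ((-2) ^ l * pochhammer (1/2) l)"
proof -
  have "pochhammer (1/2) l \<noteq> (0::real)"
    using pochhammer_pos[of "1/2::real" l] by simp
  then show ?thesis
    using prod_odd_pochhammer[of k l] prod_odd_nonzero[of k l] by (simp add: field_simps)
qed

lemma fact_times_prod: "fact k * (\<Prod>j=1..n. real k + real j) = fact n * pochhammer (real n + 1) k"
proof -
  have "(\<Prod>j=1..n. real k + real j) = pochhammer (real k + 1) n"
    by (simp add: pochhammer_prod prod.atLeast1_atMost_eq add_ac atLeast0LessThan)
  then have "fact k * (\<Prod>j=1..n. real k + real j) = pochhammer 1 (k + n)"
    unfolding pochhammer_product' pochhammer_fact by (simp add: add_ac)
  also have "\<dots> = pochhammer 1 (n + k)"
    by (simp add: add_ac)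
  also have "\<dots> = fact n * pochhammer (real n + 1) k"
    unfolding pochhammer_product' pochhammer_fact by (simp add: add_ac)
  finally show ?thesis .
qed

lemma rGamma_nat_plus_half: "rGamma (real n + 1/2) = 1 / (sqrt pi * pochhammer (1/2) n)"
proof -
  have "rGamma (1/2::real) = 1 / sqrt pi"
    by (simp add: rGamma_inverse_Gamma Gamma_one_half_real inverse_eq_divide)
  moreover have "pochhammer (1/2) n \<noteq> (0::real)"
    using pochhammer_pos[of "1/2::real" n] by simp
  ultimately show ?thesis
    using pochhammer_rGamma[of "1/2::real" n] by (simp add: field_simps)
qed

text \<open>
  Here \<open>C - A = l + n + 1/2\<close>, \<open>C - B = m + n + 1/2\<close> and \<open>C - A - B - 1 = l + m + n - 1\<close>, so the Gamma
  values are factorials and half-integer values.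
\<close>

lemma half_integer_summation:
  assumes lmn: "l + m + n \<ge> 2"
  shows "(\<lambda>k::nat. ((pochhammer (1/2) k)\<^sup>2 / (fact k)\<^sup>2) *
          ((1 - 2 * real l + 4 * real k) / ((\<Prod>j=1..l. 2 * real k - 2 * real j + 1) *
            (\<Prod>j=1..m. 2 * real k - 2 * real j + 1) *
            (\<Prod>j=1..n. real k + real j))))
        sums
      (((-1) ^ (l + m) / 2 ^ (l + m)) *
        (fact (l + m + n - 2) * (real l - real m + real n) * (1 - 2 * real l) /
          (pochhammer (1/2) l * pochhammer (1/2) m * pochhammer (1/2) (l + n) * pochhammer (1/2) (m + n))) *
        (1 / pi) :: real)"
proof -
  define A B C where "A = 1/2 - real l" and "B = 1/2 - real m" and "C = real n + 1"
  define K :: real where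
    "K = 1 / ((-2) ^ l * pochhammer (1/2) l * ((-2) ^ m * pochhammer (1/2) m) * fact n)"
  have C: "C \<notin> \<int>\<^sub>\<le>\<^sub>0"
    using nonpos_Ints_nonpos[of C] by (auto simp: C_def)
  have "Gamma (C - A - B - 1) = Gamma (1 + real (l + m + n - 2))"
    using lmn by (intro arg_cong[of _ _ Gamma]) (simp add: A_def B_def C_def of_nat_diff)
  then have G: "Gamma (C - A - B - 1) = fact (l + m + n - 2)"
    by (simp only: Gamma_fact)
  have GC: "Gamma C = fact n"
    using Gamma_fact[of n] by (simp add: C_def add_ac)
  have RA: "rGamma (C - A) = 1 / (sqrt pi * pochhammer (1/2) (l + n))"
    using rGamma_nat_plus_half[of "l + n"] by (simp add: C_def A_def algebra_simps)
  have RB: "rGamma (C - B) = 1 / (sqrt pi * pochhammer (1/2) (m + n))"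
    using rGamma_nat_plus_half[of "m + n"] by (simp add: C_def B_def algebra_simps)
  have conv: "C - A - B > 1"
    using lmn by (simp add: A_def B_def C_def)
  have "(\<lambda>k. K * ((2 * A + 4 * real k) * gauss_term A B C k)) sums
    (K * (2 * A * (C - A + B - 1) * Gamma C * Gamma (C - A - B - 1) * rGamma (C - A) * rGamma (C - B)))"
    by (intro sums_mult gauss_summation_linear_weight C conv)
  also have "(\<lambda>k. K * ((2 * A + 4 * real k) * gauss_term A B C k)) =
    (\<lambda>k::nat. ((pochhammer (1/2) k)\<^sup>2 / (fact k)\<^sup>2) *
          ((1 - 2 * real l + 4 * real k) / ((\<Prod>j=1..l. 2 * real k - 2 * real j + 1) *
            (\<Prod>j=1..m. 2 * real k - 2 * real j + 1) *
            (\<Prod>j=1..n. real k + real j))))"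
  proof
    fix k
    let ?P = "\<lambda>l. \<Prod>j=1..l. 2 * real k - 2 * real j + 1"
    have "(pochhammer (1/2) k)\<^sup>2 / (fact k)\<^sup>2 *
            ((1 - 2 * real l + 4 * real k) / (?P l * ?P m * (\<Prod>j=1..n. real k + real j))) =
          (1 - 2 * real l + 4 * real k) * (pochhammer (1/2) k / ?P l) * (pochhammer (1/2) k / ?P m) /
            (fact k * (fact k * (\<Prod>j=1..n. real k + real j)))"
      by (simp add: power2_eq_square mult_ac)
    also have "\<dots> = K * ((2 * A + 4 * real k) * gauss_term A B C k)"
      unfolding prod_odd_quotient fact_times_prod
      by (simp add: K_def A_def B_def C_def gauss_term_def mult_ac)
    finally show "K * ((2 * A + 4 * real k) * gauss_term A B C k) =
      (pochhammer (1/2) k)\<^sup>2 / (fact k)\<^sup>2 *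
            ((1 - 2 * real l + 4 * real k) / (?P l * ?P m * (\<Prod>j=1..n. real k + real j)))" ..
  qed
  also have "K * (2 * A * (C - A + B - 1) * Gamma C * Gamma (C - A - B - 1) * rGamma (C - A) * rGamma (C - B)) =
     ((-1) ^ (l + m) / 2 ^ (l + m)) *
        (fact (l + m + n - 2) * (real l - real m + real n) * (1 - 2 * real l) /
          (pochhammer (1/2) l * pochhammer (1/2) m * pochhammer (1/2) (l + n) * pochhammer (1/2) (m + n))) *
        (1 / pi)"
  proof -
    have lin: "2 * A * (C - A + B - 1) = (1 - 2 * real l) * (real l - real m + real n)"
      by (simp add: A_def B_def C_def)
    have sign: "1 / ((-2) ^ l * (-2) ^ m) = (-1) ^ (l + m) / (2 ^ (l + m) :: real)"
    proof -
      have "1 / ((-2) ^ l * (-2) ^ m) = (1 / (-2 :: real)) ^ (l + m)"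
        by (simp only: power_add power_divide power_one times_divide_times_eq mult_1_left)
      also have "\<dots> = (-1 / 2) ^ (l + m)" by simp
      finally show ?thesis by (simp only: power_divide)
    qed
    have "K * (2 * A * (C - A + B - 1) * Gamma C * Gamma (C - A - B - 1) * rGamma (C - A) * rGamma (C - B)) =
      (1 / ((-2) ^ l * (-2) ^ m)) * (fact (l + m + n - 2) * (real l - real m + real n) * (1 - 2 * real l) /
          (pochhammer (1/2) l * pochhammer (1/2) m * pochhammer (1/2) (l + n) * pochhammer (1/2) (m + n))) *
        (1 / (sqrt pi * sqrt pi))"
      unfolding lin G GC RA RB K_def by (simp add: divide_simps)
    then show ?thesis
      unfolding sign by simp
  qed
  finally show ?thesis .
qed


theorem corollary13:
  shows
   "(\<forall>l m n::nat. l + m + n \<ge> 2 \<longrightarrow>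
      (\<lambda>k::nat. ((pochhammer (1/2) k)\<^sup>2 / (fact k)\<^sup>2) *
          ((1 - 2 * real l + 4 * real k) / ((\<Prod>j=1..l. 2 * real k - 2 * real j + 1) *
            (\<Prod>j=1..m. 2 * real k - 2 * real j + 1) *
            (\<Prod>j=1..n. real k + real j))))
        sums
      (((-1) ^ (l + m) / 2 ^ (l + m)) *
        (fact (l + m + n - 2) * (real l - real m + real n) * (1 - 2 * real l) /
          (pochhammer (1/2) l * pochhammer (1/2) m * pochhammer (1/2) (l + n) * pochhammer (1/2) (m + n))) *
        (1 / pi) :: real)) \<and>
    (\<forall>m n::nat. m + n \<ge> 2 \<longrightarrow>
      (\<lambda>k::nat. ((pochhammer (1/2) k)\<^sup>2 / (fact k)\<^sup>2) *
          ((1 + 4 * real k) / ((\<Prod>j=1..m. 2 * real k - 2 * real j + 1) *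
            (\<Prod>j=1..n. real k + real j))))
        sums
      (((-1) ^ m / 2 ^ m) *
        (fact (m + n - 2) * (real n - real m) /
          (pochhammer (1/2) m * pochhammer (1/2) n * pochhammer (1/2) (m + n))) *
        (1 / pi) :: real)) \<and>
    (\<forall>n::nat. n \<ge> 2 \<longrightarrow>
      (\<lambda>k::nat. ((pochhammer (1/2) k)\<^sup>2 / (fact k)\<^sup>2) *
          ((1 + 4 * real k) / ((\<Prod>j=1..n. real k + real j))))
        sums
      ((fact (n - 2) * real n / (pochhammer (1/2) n)\<^sup>2) * (1 / pi) :: real)) \<and>
    (\<forall>n::nat. n \<ge> 2 \<longrightarrow>
      (\<lambda>k::nat. ((pochhammer (1/2) k)\<^sup>2 / (fact k)\<^sup>2) *
          ((1 + 4 * real k) / ((\<Prod>j=1..n. 2 * real k - 2 * real j + 1))))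
        sums
      (((-1) ^ (n + 1) / 2 ^ n) *
        (fact (n - 2) * real n / (pochhammer (1/2) n)\<^sup>2) * (1 / pi) :: real)) \<and>
    (\<forall>n::nat. n \<ge> 2 \<longrightarrow>
      (\<lambda>k::nat. ((pochhammer (1/2) k)\<^sup>2 / (fact k)\<^sup>2) *
          ((1 - 2 * real n + 4 * real k) / ((\<Prod>j=1..n. 2 * real k - 2 * real j + 1))))
        sums
      (((-1) ^ n / 2 ^ n) *
        (fact (n - 2) * real n * (1 - 2 * real n) / (pochhammer (1/2) n)\<^sup>2) * (1 / pi) :: real))"
proof (intro conjI allI impI, goal_cases)
  case (1 l m n)
  then show ?case by (rule half_integer_summation)
next
  case (2 m n)
  then show ?case using half_integer_summation[of 0 m n] by (simp add: mult_ac)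
next
  case (3 n)
  then show ?case using half_integer_summation[of 0 0 n] by (simp add: power2_eq_square)
next
  case (4 n)
  then show ?case using half_integer_summation[of 0 n 0] by (simp add: power2_eq_square)
next
  case (5 n)
  then show ?case using half_integer_summation[of n 0 0] by (simp add: power2_eq_square)
qed

end
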